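(* Let $E$ be a finite-dimensional Hilbert space and $J=J^*=J^{-1}\in[E,E]$. Let $\Theta_L$ be an $L$-system with state-space operator $\mathbb A$, main operator $T$, channel operator $K_1$, direction operator $J$ and rigged Hilbert space $\mathcal H_{+1}\subset\mathcal H_1\subset\mathcal H_{-1}$, and let $\Theta_F$ be an $F$-system with operators $M$, $F$, $K_2$, $J$, state space $\mathcal H_2$ and the same input-output space $E$. Let $\Theta_{LF}=\Theta_L\cdot\Theta_F$ be the $LF$-coupling of $\Theta_L$ and $\Theta_F$. Then the associated transfer functions satisfy $$W_{\Theta_{LF}}(z)=W_{\Theta_L}(z)\,W_{\Theta_F}(z),\qquad z\in\rho(T)\cap\rho(M,F).$$
   Context: $[X,Y]$ denotes the bounded linear operators from $X$ to $Y$. $\mathrm{Im}\,S=(S-S^* )/(2i)$, $\mathrm{Re}\,S=(S+S^* )/2$. **$L$-system.** Let $\dot A$ be a closed, densely defined symmetric operator with finite equal deficiency indices in a Hilbert space $\mathcal H_1$. Let $\mathcal H_{+1}=\mathrm{Dom}(\dot A^* )$ with inner product $(f,g)_+=(f,g)+(\dot A^*f,\dot A^*g)$, and let $\mathcal H_{+1}\subset\mathcal H_1\subset\mathcal H_{-1}$ be the corresponding rigged Hilbert space ($\mathcal H_{-1}$ is the dual of $\mathcal H_{+1}$ with respect to the pairing extending the inner product of $\mathcal H_1$). The conjugate of $\mathcal H_{\pm1}$ is identified with $\mathcal H_{\mp1}$, so that the adjoint of an operator in $[\mathcal H_{+1},\mathcal H_{-1}]$ is again in $[\mathcal H_{+1},\mathcal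 H_{-1}]$. A quasi-self-adjoint extension of $\dot A$ is a non-symmetric operator $T$ with $\dot A\subset T\subset\dot A^*$; it belongs to the class $\Lambda(\dot A)$ if its resolvent set $\rho(T)$ is nonempty and $\mathrm{Dom}(\dot A)=\mathrm{Dom}(T)\cap\mathrm{Dom}(T^* )$. An operator $\mathbb A\in[\mathcal H_{+1},\mathcal H_{-1}]$ is a $( * )$-extension of $T$ if $\mathbb A\supset T\supset\dot A$, $\mathbb A^*\supset T^*\supset\dot A$, and the operator $\hat A$ (quasi-kernel of $\mathrm{Re}\,\mathbb A$) obtained by restricting $\mathrm{Re}\,\mathbb A$ to $\{f\in\mathcal H_{+1}:\mathrm{Re}\,\mathbb A f\in\mathcal H_1\}$ is self-adjoint in $\mathcal H_1$. An $L$-system $$\Theta_L=\begin{pmatrix}\mathbb A&K_1&J\\ \mathcal H_{+1}\subset\mathcal H_1\subset\mathcal H_{-1}&&E\end{pmatrix}$$ consists of such data where: $\mathbb A$ is a $( * )$-extension of an operator $T\in\Lambda(\dot A)$; $J=J^*=J^{-1}\in[E,E]$, $\dim E<\infty$; $\mathrm{Im}\,\mathbb A=K_1JK_1^*$ with $K_1\in[E,\mathcal H_{-1}]$, $K_1^*\in[\mathcal H_{+1},E]$, $\mathrm{Ran}(K_1)=\mathrm{Ran}(\mathrm{Im}\,\mathbb A)$. $T$ is called the main operator. The transfer function is $W_{\Theta_L}(z)=I-2iK_1^*(\mathbb A-zI)^{-1}K_1J$, $z\in\rho(T)$ (it is known that for $z\in\rho(T)$ the equation $(\mathbb A-zI)x=K_1e$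 has a unique solution $x\in\mathcal H_{+1}$ for each $e\in E$). **$F$-system.** For a closed operator $A$ and an orthogonal projection $F$ in a Hilbert space $\mathcal H_2$, $\rho(A,F)$ is the set of $z\in\mathbb C$ such that $A-zF$ is boundedly invertible with $(A-zF)^{-1}$ defined on all of $\mathcal H_2$. An $F$-system $$\Theta_F=\begin{pmatrix}M\ \ F&K_2&J\\ \mathcal H_2&&E\end{pmatrix}$$ consists of $M\in[\mathcal H_2,\mathcal H_2]$, $J=J^*=J^{-1}\in[E,E]$, $K_2\in[E,\mathcal H_2]$ with $\mathrm{Im}\,M=K_2JK_2^*$, and an orthogonal projection $F$ in $\mathcal H_2$, such that $\rho(\mathrm{Re}\,M,F)$ and $\rho(M,F)$ are nonempty. Its transfer function is $W_{\Theta_F}(z)=I-2iK_2^*(M-zF)^{-1}K_2J$, $z\in\rho(M,F)$. **$LF$-coupling.** Put $\mathcal H_\pm=\mathcal H_{\pm1}\oplus\mathcal H_2$, $\mathcal H=\mathcal H_1\oplus\mathcal H_2$, and define $\mathbb M\in[\mathcal H_+,\mathcal H_-]$, $\mathbb F:\mathcal H\to\mathcal H$, $K:E\to\mathcal H_-$ by $$\mathbb M=\begin{pmatrix}\mathbb A&2iK_1JK_2^*\\ 0&M\end{pmatrix},\quad \mathbb F=\begin{pmatrix}I&0\\ 0&F\end{pmatrix},\quad K=\begin{pmatrix}K_1\\ K_2\end{pmatrix}.$$ The $LF$-coupling is the aggregate $\Theta_{LF}=\Theta_L\cdot\Theta_F=\begin{pmatrix}\mathbb M\ \ \mathbb F&K&J\\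 \mathcal H_+\subset\mathcal H\subset\mathcal H_-&&E\end{pmatrix}$, and its transfer function is $W_{\Theta_{LF}}(z)=I-2iK^*(\mathbb M-z\mathbb F)^{-1}KJ$, where $(\mathbb M-z\mathbb F)^{-1}Ke$ denotes the unique solution $x\in\mathcal H_+$ of $(\mathbb M-z\mathbb F)x=Ke$. *)

theory Defs
  imports "HOL-Analysis.Analysis" "HOL-Library.Function_Algebras"
begin

section \<open>Complex vector spaces and complex Hilbert spaces\<close>

class complex_vector = real_vector +
  fixes scaleC :: "complex \<Rightarrow> 'a \<Rightarrow> 'a"  (infixr "*\<^sub>C" 75)
  assumes scaleC_add_right: "c *\<^sub>C (x + y) = c *\<^sub>C x + c *\<^sub>C y"
    and scaleC_add_left: "(c + d) *\<^sub>C x = c *\<^sub>C x + d *\<^sub>C x"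
    and scaleC_scaleC: "c *\<^sub>C (d *\<^sub>C x) = (c * d) *\<^sub>C x"
    and scaleR_scaleC: "r *\<^sub>R x = complex_of_real r *\<^sub>C x"

lemma scaleC_one: "1 *\<^sub>C (x :: 'a :: complex_vector) = x"
  using scaleR_scaleC[of 1 x] by simp

global_interpretation cvs: vector_space "scaleC :: complex \<Rightarrow> 'a \<Rightarrow> 'a :: complex_vector"
  by unfold_locales
    (simp_all add: scaleC_add_right scaleC_add_left scaleC_scaleC scaleC_one)

text \<open>The inner product is linear in the first and antilinear in the second argument. Norm and
  topology are those of the underlying real inner product space with inner product
  \<open>Re (cinner x y)\<close>.\<close>

class complex_inner = complex_vector + real_inner +
  fixes cinner :: "'a \<Rightarrow> 'a \<Rightarrow> complex"
  assumes cinner_add_left: "cinner (x + y) z = cinner x z + cinner y z"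
    and cinner_scaleC_left: "cinner (c *\<^sub>C x) y = c * cinner x y"
    and cinner_commute: "cinner x y = cnj (cinner y x)"
    and inner_eq_Re_cinner: "inner x y = Re (cinner x y)"

class chilbert_space = complex_inner + complete_space

instantiation complex :: chilbert_space
begin

definition scaleC_complex_def: "(c :: complex) *\<^sub>C (x :: complex) = c * x"
definition cinner_complex_def: "cinner (x :: complex) y = x * cnj y"

instance
  by standard (simp_all add: scaleC_complex_def cinner_complex_def algebra_simps
      scaleR_conv_of_real inner_complex_def)

end

instantiation prod :: (complex_vector, complex_vector) complex_vector
begin

definition scaleC_prod_def: "c *\<^sub>C (x :: 'a \<times> 'b) = (c *\<^sub>C fst x, c *\<^sub>C snd x)"

instance
  by standard (simp_all add: scaleC_prod_def scaleC_add_right scaleC_add_left scaleC_scaleC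
      scaleR_scaleC scaleR_prod_def)

end

instantiation prod :: (complex_inner, complex_inner) complex_inner
begin

definition cinner_prod_def:
  "cinner (x :: 'a \<times> 'b) y = cinner (fst x) (fst y) + cinner (snd x) (snd y)"

instance
proof
  fix x y z :: "'a \<times> 'b" and c :: complex
  show "cinner (x + y) z = cinner x z + cinner y z"
    by (simp add: cinner_prod_def cinner_add_left)
  show "cinner (c *\<^sub>C x) y = c * cinner x y"
    by (simp add: cinner_prod_def scaleC_prod_def cinner_scaleC_left distrib_left)
  show "cinner x y = cnj (cinner y x)"
    unfolding cinner_prod_def complex_cnj_add
    by (simp only: cinner_commute[symmetric])
  show "inner x y = Re (cinner x y)"
    by (simp add: cinner_prod_def inner_prod_def inner_eq_Re_cinner)
qed

end

instance prod :: (chilbert_space, chilbert_space) chilbert_space ..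

instantiation "fun" :: (type, real_vector) real_vector
begin

definition scaleR_fun_def: "r *\<^sub>R (f :: 'a \<Rightarrow> 'b) = (\<lambda>x. r *\<^sub>R f x)"

instance
  by standard (simp_all add: scaleR_fun_def plus_fun_def scaleR_add_right scaleR_add_left)

end

instantiation "fun" :: (type, complex_vector) complex_vector
begin

definition scaleC_fun_def: "c *\<^sub>C (f :: 'a \<Rightarrow> 'b) = (\<lambda>x. c *\<^sub>C f x)"

instance
  by standard (simp_all add: scaleC_fun_def scaleR_fun_def plus_fun_def scaleC_add_right
      scaleC_add_left scaleC_scaleC scaleR_scaleC)

end

definition finite_cdim :: "'a :: complex_vector set \<Rightarrow> bool" where
  "finite_cdim S \<longleftrightarrow> (\<exists>B. finite B \<and> S \<subseteq> cvs.span B)"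


section \<open>Bounded operators and adjoints\<close>

text \<open>\<open>bounded_ops X nX Y nY\<close> is \<open>[X,Y]\<close> for subspaces \<open>X\<close>, \<open>Y\<close> normed by \<open>nX\<close>, \<open>nY\<close>. Only the
  values of an operator on \<open>X\<close> matter.\<close>

definition bounded_ops ::
  "'x :: complex_vector set \<Rightarrow> ('x \<Rightarrow> real) \<Rightarrow> 'y :: complex_vector set \<Rightarrow> ('y \<Rightarrow> real) \<Rightarrow> ('x \<Rightarrow> 'y) set"
  where
  "bounded_ops X nX Y nY = {S.
     (\<forall>x\<in>X. S x \<in> Y) \<and>
     (\<forall>x\<in>X. \<forall>y\<in>X. S (x + y) = S x + S y) \<and>
     (\<forall>c. \<forall>x\<in>X. S (c *\<^sub>C x) = c *\<^sub>C S x) \<and>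
     (\<exists>C. \<forall>x\<in>X. nY (S x) \<le> C * nX x)}"

abbreviation hilbert_ops :: "('x :: complex_inner \<Rightarrow> 'y :: complex_inner) set" where
  "hilbert_ops \<equiv> bounded_ops UNIV norm UNIV norm"

text \<open>The adjoint \<open>K\<^sup>*\<close>, characterised by \<open>\<langle>K e, x\<rangle> = (e, K\<^sup>* x)\<close>, where \<open>p\<close> is the pairing
  \<open>\<langle>\<cdot>,\<cdot>\<rangle>\<close>.\<close>

definition pairing_adjoint ::
  "('y \<Rightarrow> 'x \<Rightarrow> complex) \<Rightarrow> ('e :: complex_inner \<Rightarrow> 'y) \<Rightarrow> 'x \<Rightarrow> 'e" where
  "pairing_adjoint p K x = (THE u. \<forall>e. p (K e) x = cinner e u)"

abbreviation hilbert_adjoint :: "('x :: complex_inner \<Rightarrow> 'y :: complex_inner) \<Rightarrow> 'y \<Rightarrow> 'x" where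
  "hilbert_adjoint \<equiv> pairing_adjoint cinner"

definition Re_op :: "('x :: complex_inner \<Rightarrow> 'x) \<Rightarrow> 'x \<Rightarrow> 'x" where
  "Re_op S x = (1 / 2) *\<^sub>C (S x + hilbert_adjoint S x)"

definition Im_op :: "('x :: complex_inner \<Rightarrow> 'x) \<Rightarrow> 'x \<Rightarrow> 'x" where
  "Im_op S x = (1 / (2 * \<i>)) *\<^sub>C (S x - hilbert_adjoint S x)"

definition orthogonal_projection :: "('x :: complex_inner \<Rightarrow> 'x) \<Rightarrow> bool" where
  "orthogonal_projection F \<longleftrightarrow> F \<in> hilbert_ops \<and> F \<circ> F = F \<and> hilbert_adjoint F = F"

definition signature_op :: "('e :: complex_inner \<Rightarrow> 'e) \<Rightarrow> bool" where
  "signature_op J \<longleftrightarrow> J \<in> hilbert_ops \<and> hilbert_adjoint J = J \<and> J \<circ> J = id"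


section \<open>Unbounded operators\<close>

text \<open>Unbounded operators are represented by their graphs, so that \<open>A \<subseteq> B\<close> means that \<open>B\<close> extends
  \<open>A\<close>.\<close>

definition linear_operator :: "('h :: complex_vector \<times> 'h) set \<Rightarrow> bool" where
  "linear_operator A \<longleftrightarrow> cvs.subspace A \<and> single_valued A"

definition op_apply :: "('h \<times> 'h) set \<Rightarrow> 'h \<Rightarrow> 'h" where
  "op_apply A f = (THE h. (f, h) \<in> A)"

definition graph_of :: "('h \<Rightarrow> 'h) \<Rightarrow> ('h \<times> 'h) set" where
  "graph_of S = {(f, S f) | f. True}"

definition densely_defined :: "('h :: topological_space \<times> 'h) set \<Rightarrow> bool" where
  "densely_defined A \<longleftrightarrow> closure (Domain A) = UNIV"

definition adjoint_op :: "('h :: complex_inner \<times> 'h) set \<Rightarrow> ('h \<times> 'h) set" where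
  "adjoint_op A = {(g, k). \<forall>(f, h) \<in> A. cinner h g = cinner f k}"

definition symmetric_operator :: "('h :: complex_inner \<times> 'h) set \<Rightarrow> bool" where
  "symmetric_operator A \<longleftrightarrow> A \<subseteq> adjoint_op A"

definition selfadjoint_operator :: "('h :: complex_inner \<times> 'h) set \<Rightarrow> bool" where
  "selfadjoint_operator A \<longleftrightarrow> linear_operator A \<and> densely_defined A \<and> adjoint_op A = A"

definition deficiency_space :: "('h :: complex_inner \<times> 'h) set \<Rightarrow> complex \<Rightarrow> 'h set" where
  "deficiency_space A z = {f. (f, z *\<^sub>C f) \<in> adjoint_op A}"

definition finite_equal_deficiency_indices :: "('h :: complex_inner \<times> 'h) set \<Rightarrow> bool" where
  "finite_equal_deficiency_indices A \<longleftrightarrow>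
     finite_cdim (deficiency_space A \<i>) \<and> finite_cdim (deficiency_space A (- \<i>)) \<and>
     cvs.dim (deficiency_space A \<i>) = cvs.dim (deficiency_space A (- \<i>))"

text \<open>\<open>\<rho>(A,F)\<close>: the inverse relation of \<open>A - z F\<close> is the graph of an everywhere defined bounded
  operator.\<close>

definition F_resolvent_set :: "('h :: complex_inner \<times> 'h) set \<Rightarrow> ('h \<Rightarrow> 'h) \<Rightarrow> complex set" where
  "F_resolvent_set A F =
     {z. \<exists>R \<in> hilbert_ops. {(k - z *\<^sub>C F f, f) | f k. (f, k) \<in> A} = graph_of R}"

definition resolvent_set :: "('h :: complex_inner \<times> 'h) set \<Rightarrow> complex set" where
  "resolvent_set T = F_resolvent_set T id"

definition quasi_selfadjoint_extension ::
  "('h :: complex_inner \<times> 'h) set \<Rightarrow> ('h \<times> 'h) set \<Rightarrow> bool" where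
  "quasi_selfadjoint_extension A T \<longleftrightarrow>
     linear_operator T \<and> \<not> symmetric_operator T \<and> A \<subseteq> T \<and> T \<subseteq> adjoint_op A"

definition class_Lambda :: "('h :: complex_inner \<times> 'h) set \<Rightarrow> ('h \<times> 'h) set set" where
  "class_Lambda A = {T. quasi_selfadjoint_extension A T \<and> resolvent_set T \<noteq> {} \<and>
     Domain A = Domain T \<inter> Domain (adjoint_op T)}"


section \<open>The rigged Hilbert space of a symmetric operator\<close>

definition plus_space :: "('h :: complex_inner \<times> 'h) set \<Rightarrow> 'h set" where
  "plus_space A = Domain (adjoint_op A)"

definition plus_inner :: "('h :: complex_inner \<times> 'h) set \<Rightarrow> 'h \<Rightarrow> 'h \<Rightarrow> complex" where
  "plus_inner A f g =
     cinner f g + cinner (op_apply (adjoint_op A) f) (op_apply (adjoint_op A) g)"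

definition plus_norm :: "('h :: complex_inner \<times> 'h) set \<Rightarrow> 'h \<Rightarrow> real" where
  "plus_norm A f = sqrt (Re (plus_inner A f f))"

text \<open>\<open>H\<^sub>-\<^sub>1\<close> consists of the bounded antilinear functionals on \<open>H\<^sub>+\<^sub>1\<close>, extended by \<open>0\<close> outside \<open>H\<^sub>+\<^sub>1\<close>
  so that equality of elements of \<open>H\<^sub>-\<^sub>1\<close> is equality of functions. The pairing of \<open>\<phi> \<in> H\<^sub>-\<^sub>1\<close> with
  \<open>f \<in> H\<^sub>+\<^sub>1\<close> is \<open>\<phi> f\<close>; it extends the inner product of \<open>H\<^sub>1\<close> because \<open>h \<in> H\<^sub>1\<close> is identified with the
  functional \<open>f \<mapsto> (h,f)\<close>.\<close>

definition minus_space :: "('h :: complex_inner \<times> 'h) set \<Rightarrow> ('h \<Rightarrow> complex) set" where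
  "minus_space A = {\<phi>.
     (\<forall>f. f \<notin> plus_space A \<longrightarrow> \<phi> f = 0) \<and>
     (\<forall>f \<in> plus_space A. \<forall>g \<in> plus_space A. \<phi> (f + g) = \<phi> f + \<phi> g) \<and>
     (\<forall>c. \<forall>f \<in> plus_space A. \<phi> (c *\<^sub>C f) = cnj c * \<phi> f) \<and>
     (\<exists>C. \<forall>f \<in> plus_space A. cmod (\<phi> f) \<le> C * plus_norm A f)}"

definition minus_norm :: "('h :: complex_inner \<times> 'h) set \<Rightarrow> ('h \<Rightarrow> complex) \<Rightarrow> real" where
  "minus_norm A \<phi> = (SUP f \<in> {f \<in> plus_space A. plus_norm A f \<le> 1}. cmod (\<phi> f))"

definition rig_embed :: "('h :: complex_inner \<times> 'h) set \<Rightarrow> 'h \<Rightarrow> 'h \<Rightarrow> complex" where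
  "rig_embed A h = (\<lambda>f. if f \<in> plus_space A then cinner h f else 0)"

definition rig_pairing :: "('h \<Rightarrow> complex) \<Rightarrow> 'h \<Rightarrow> complex" where
  "rig_pairing \<phi> f = \<phi> f"

abbreviation rig_ops :: "('h :: complex_inner \<times> 'h) set \<Rightarrow> ('h \<Rightarrow> 'h \<Rightarrow> complex) set" where
  "rig_ops A \<equiv> bounded_ops (plus_space A) (plus_norm A) (minus_space A) (minus_norm A)"

text \<open>The adjoint in \<open>[H\<^sub>+\<^sub>1,H\<^sub>-\<^sub>1]\<close>: the pairing of \<open>S\<^sup>* g\<close> with \<open>f\<close> is the complex conjugate of the
  pairing of \<open>S f\<close> with \<open>g\<close>.\<close>

definition rig_adjoint ::
  "('h :: complex_inner \<times> 'h) set \<Rightarrow> ('h \<Rightarrow> 'h \<Rightarrow> complex) \<Rightarrow> 'h \<Rightarrow> 'h \<Rightarrow> complex" where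
  "rig_adjoint A S g =
     (\<lambda>f. if f \<in> plus_space A then cnj (rig_pairing (S f) g) else 0)"

definition rig_Re ::
  "('h :: complex_inner \<times> 'h) set \<Rightarrow> ('h \<Rightarrow> 'h \<Rightarrow> complex) \<Rightarrow> 'h \<Rightarrow> 'h \<Rightarrow> complex" where
  "rig_Re A S f = (1 / 2) *\<^sub>C (S f + rig_adjoint A S f)"

definition rig_Im ::
  "('h :: complex_inner \<times> 'h) set \<Rightarrow> ('h \<Rightarrow> 'h \<Rightarrow> complex) \<Rightarrow> 'h \<Rightarrow> 'h \<Rightarrow> complex" where
  "rig_Im A S f = (1 / (2 * \<i>)) *\<^sub>C (S f - rig_adjoint A S f)"

definition rig_extends ::
  "('h :: complex_inner \<times> 'h) set \<Rightarrow> ('h \<Rightarrow> 'h \<Rightarrow> complex) \<Rightarrow> ('h \<times> 'h) set \<Rightarrow> bool" where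
  "rig_extends A S T \<longleftrightarrow> (\<forall>(f, h) \<in> T. f \<in> plus_space A \<and> S f = rig_embed A h)"

definition quasi_kernel ::
  "('h :: complex_inner \<times> 'h) set \<Rightarrow> ('h \<Rightarrow> 'h \<Rightarrow> complex) \<Rightarrow> ('h \<times> 'h) set" where
  "quasi_kernel A S = {(f, h). f \<in> plus_space A \<and> rig_Re A S f = rig_embed A h}"

definition star_extension ::
  "('h :: complex_inner \<times> 'h) set \<Rightarrow> ('h \<times> 'h) set \<Rightarrow> ('h \<Rightarrow> 'h \<Rightarrow> complex) \<Rightarrow> bool" where
  "star_extension A T S \<longleftrightarrow>
     S \<in> rig_ops A \<and>
     rig_extends A S T \<and> A \<subseteq> T \<and>
     rig_extends A (rig_adjoint A S) (adjoint_op T) \<and> A \<subseteq> adjoint_op T \<and>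
     selfadjoint_operator (quasi_kernel A S)"


section \<open>L-systems\<close>

record ('h, 'e) L_data =
  L_symm :: "('h \<times> 'h) set"
  L_main :: "('h \<times> 'h) set"
  L_state :: "'h \<Rightarrow> 'h \<Rightarrow> complex"
  L_channel :: "'e \<Rightarrow> 'h \<Rightarrow> complex"
  L_direction :: "'e \<Rightarrow> 'e"

definition L_channel_adjoint ::
  "('h :: chilbert_space, 'e :: chilbert_space) L_data \<Rightarrow> 'h \<Rightarrow> 'e" where
  "L_channel_adjoint \<Theta> = pairing_adjoint rig_pairing (L_channel \<Theta>)"

definition L_system :: "('h :: chilbert_space, 'e :: chilbert_space) L_data \<Rightarrow> bool" where
  "L_system \<Theta> \<longleftrightarrow>
    (let A = L_symm \<Theta>; T = L_main \<Theta>; S = L_state \<Theta>; K = L_channel \<Theta>; J = L_direction \<Theta>;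
         K' = L_channel_adjoint \<Theta>
     in linear_operator A \<and> closed A \<and> densely_defined A \<and> symmetric_operator A \<and>
        finite_equal_deficiency_indices A \<and>
        T \<in> class_Lambda A \<and> star_extension A T S \<and>
        finite_cdim (UNIV :: 'e set) \<and> signature_op J \<and>
        K \<in> bounded_ops UNIV norm (minus_space A) (minus_norm A) \<and>
        K' \<in> bounded_ops (plus_space A) (plus_norm A) UNIV norm \<and>
        (\<forall>f \<in> plus_space A. rig_Im A S f = K (J (K' f))) \<and>
        range K = rig_Im A S ` plus_space A)"

definition L_transfer ::
  "('h :: chilbert_space, 'e :: chilbert_space) L_data \<Rightarrow> complex \<Rightarrow> 'e \<Rightarrow> 'e" where
  "L_transfer \<Theta> z e =
     e - (2 * \<i>) *\<^sub>C L_channel_adjoint \<Theta>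
       (THE x. x \<in> plus_space (L_symm \<Theta>) \<and>
          L_state \<Theta> x - z *\<^sub>C rig_embed (L_symm \<Theta>) x = L_channel \<Theta> (L_direction \<Theta> e))"


section \<open>F-systems\<close>

record ('h, 'e) F_data =
  F_state :: "'h \<Rightarrow> 'h"
  F_proj :: "'h \<Rightarrow> 'h"
  F_channel :: "'e \<Rightarrow> 'h"
  F_direction :: "'e \<Rightarrow> 'e"

definition F_system :: "('h :: chilbert_space, 'e :: chilbert_space) F_data \<Rightarrow> bool" where
  "F_system \<Theta> \<longleftrightarrow>
    (let M = F_state \<Theta>; F = F_proj \<Theta>; K = F_channel \<Theta>; J = F_direction \<Theta>
     in M \<in> hilbert_ops \<and> signature_op J \<and> K \<in> hilbert_ops \<and>
        Im_op M = K \<circ> J \<circ> hilbert_adjoint K \<and>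
        orthogonal_projection F \<and>
        F_resolvent_set (graph_of (Re_op M)) F \<noteq> {} \<and>
        F_resolvent_set (graph_of M) F \<noteq> {})"

definition F_transfer ::
  "('h :: chilbert_space, 'e :: chilbert_space) F_data \<Rightarrow> complex \<Rightarrow> 'e \<Rightarrow> 'e" where
  "F_transfer \<Theta> z e =
     e - (2 * \<i>) *\<^sub>C hilbert_adjoint (F_channel \<Theta>)
       (inv (\<lambda>h. F_state \<Theta> h - z *\<^sub>C F_proj \<Theta> h) (F_channel \<Theta> (F_direction \<Theta> e)))"


section \<open>LF-couplings\<close>

text \<open>The symmetric operator \<open>LF_symm\<close> is kept because it determines the rigging of the first
  component; the triple is \<open>H\<^sub>+\<^sub>1 \<oplus> H\<^sub>2 \<subset> H\<^sub>1 \<oplus> H\<^sub>2 \<subset> H\<^sub>-\<^sub>1 \<oplus> H\<^sub>2\<close>.\<close>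

record ('h1, 'h2, 'e) LF_data =
  LF_symm :: "('h1 \<times> 'h1) set"
  LF_state :: "'h1 \<times> 'h2 \<Rightarrow> ('h1 \<Rightarrow> complex) \<times> 'h2"
  LF_proj :: "'h1 \<times> 'h2 \<Rightarrow> 'h1 \<times> 'h2"
  LF_channel :: "'e \<Rightarrow> ('h1 \<Rightarrow> complex) \<times> 'h2"
  LF_direction :: "'e \<Rightarrow> 'e"

definition LF_plus_space :: "('h1 :: complex_inner \<times> 'h1) set \<Rightarrow> ('h1 \<times> 'h2) set" where
  "LF_plus_space A = plus_space A \<times> UNIV"

definition LF_embed ::
  "('h1 :: complex_inner \<times> 'h1) set \<Rightarrow> 'h1 \<times> 'h2 \<Rightarrow> ('h1 \<Rightarrow> complex) \<times> 'h2" where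
  "LF_embed A = (\<lambda>(f, h). (rig_embed A f, h))"

definition LF_pairing ::
  "('h1 \<Rightarrow> complex) \<times> 'h2 :: complex_inner \<Rightarrow> 'h1 \<times> 'h2 \<Rightarrow> complex" where
  "LF_pairing = (\<lambda>(\<phi>, k) (f, h). rig_pairing \<phi> f + cinner k h)"

definition LF_coupling ::
  "('h1 :: chilbert_space, 'e :: chilbert_space) L_data \<Rightarrow> ('h2 :: chilbert_space, 'e) F_data \<Rightarrow>
     ('h1, 'h2, 'e) LF_data" where
  "LF_coupling \<Theta>L \<Theta>F = \<lparr>
     LF_symm = L_symm \<Theta>L,
     LF_state = (\<lambda>(f, h).
       (L_state \<Theta>L f +
          (2 * \<i>) *\<^sub>C L_channel \<Theta>L (L_direction \<Theta>L (hilbert_adjoint (F_channel \<Theta>F) h)),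
        F_state \<Theta>F h)),
     LF_proj = (\<lambda>(f, h). (f, F_proj \<Theta>F h)),
     LF_channel = (\<lambda>e. (L_channel \<Theta>L e, F_channel \<Theta>F e)),
     LF_direction = L_direction \<Theta>L \<rparr>"

definition LF_transfer ::
  "('h1 :: chilbert_space, 'h2 :: chilbert_space, 'e :: chilbert_space) LF_data \<Rightarrow>
     complex \<Rightarrow> 'e \<Rightarrow> 'e" where
  "LF_transfer \<Theta> z e =
     e - (2 * \<i>) *\<^sub>C pairing_adjoint LF_pairing (LF_channel \<Theta>)
       (THE x. x \<in> LF_plus_space (LF_symm \<Theta>) \<and>
          LF_state \<Theta> x - z *\<^sub>C LF_embed (LF_symm \<Theta>) (LF_proj \<Theta> x) =
            LF_channel \<Theta> (LF_direction \<Theta> e))"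

end

theory Submission
  imports Defs
begin

text \<open>The state equation of the coupling is triangular. Its second row \<open>(M - z F) h = K\<^sub>2 J e\<close> is the
  state equation of the \<open>F\<close>-system with input \<open>e\<close>. Once \<open>h\<close> is known, its first row is the state
  equation of the \<open>L\<close>-system whose input is \<open>e - 2i K\<^sub>2\<^sup>* h\<close>, that is, the output \<open>W\<^sub>F e\<close>. The channel
  adjoint of the coupling adds the two outputs, so its transfer function is the composition.

  This calculation needs the state equation \<open>(S - z) x = K\<^sub>1 e\<close> of the \<open>L\<close>-system, where \<open>S\<close> is the
  state-space operator, to have exactly one solution for \<open>z\<close> in the resolvent set of the main
  operator \<open>T\<close>; proving that is the bulk of the work (lemma \<open>L_system_resolvent\<close>).

  Uniqueness rests on \<open>T\<^sup>*\<^sup>* = T\<close>: if \<open>S x = z x\<close>, then testing against \<open>Dom T\<^sup>*\<close> shows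
  \<open>(x, z x) \<in> T\<^sup>*\<^sup>* = T\<close>, so \<open>x = 0\<close>.

  Existence holds because \<open>K\<^sub>1 e\<close> lies in the range of \<open>Im S\<close>, although \<open>S - z\<close> need not map onto
  \<open>H\<^sub>-\<^sub>1\<close>. The range of \<open>S - z\<close> contains \<open>H\<^sub>1\<close>, since \<open>T - z\<close> is already onto \<open>H\<^sub>1\<close>; hence it is enough
  to solve the equation modulo \<open>H\<^sub>1\<close>. There \<open>S\<^sup>*\<close> vanishes on \<open>Dom T\<^sup>*\<close> and equals \<open>-S\<close> on the domain of
  the quasi-kernel of \<open>Re S\<close>. These two domains together span \<open>H\<^sub>+\<^sub>1\<close> (lemma
  \<open>plus_space_decomposition\<close>), so modulo \<open>H\<^sub>1\<close> the range of \<open>S\<^sup>*\<close>, and with it that of \<open>Im S\<close>, lies in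
  the range of \<open>S\<close>.

  The spanning statement is a duality argument. Let \<open>A\<close> be the symmetric operator that underlies the
  rigging, so that \<open>H\<^sub>+\<^sub>1 = Dom A\<^sup>*\<close>. The sum of the graphs of the quasi-kernel and of
  \<open>T\<^sup>*\<close> lies between \<open>A\<close> and \<open>A\<^sup>*\<close>, and its adjoint is contained in \<open>A\<close>. Such an intermediate graph
  equals its second adjoint, because it is a finite-dimensional extension of the closed graph
  \<open>A\<close> (lemma \<open>adjoint_adjoint_intermediate\<close>; this is where the finite deficiency indices enter),
  and therefore it is all of \<open>A\<^sup>*\<close>.\<close>


section \<open>Sesquilinear algebra\<close>

lemma cinner_add_right: "cinner (x :: 'a :: complex_inner) (y + z) = cinner x y + cinner x z"
  by (metis cinner_add_left cinner_commute complex_cnj_add)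

lemma cinner_scaleC_right: "cinner (x :: 'a :: complex_inner) (c *\<^sub>C y) = cnj c * cinner x y"
  by (metis cinner_commute cinner_scaleC_left complex_cnj_mult)

lemma cinner_zero_left [simp]: "cinner 0 (y :: 'a :: complex_inner) = 0"
  using cinner_add_left[of 0 0 y] by simp

lemma cinner_zero_right [simp]: "cinner (y :: 'a :: complex_inner) 0 = 0"
  using cinner_add_right[of y 0 0] by simp

lemma cinner_minus_left: "cinner (- x) (y :: 'a :: complex_inner) = - cinner x y"
  using cinner_add_left[of x "- x" y] by (simp add: add_eq_0_iff)

lemma cinner_minus_right: "cinner (x :: 'a :: complex_inner) (- y) = - cinner x y"
  using cinner_add_right[of x y "- y"] by (simp add: add_eq_0_iff)

lemma cinner_diff_left: "cinner (x - y) (z :: 'a :: complex_inner) = cinner x z - cinner y z"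
  using cinner_add_left[of x "- y" z] by (simp add: cinner_minus_left)

lemma cinner_diff_right: "cinner (z :: 'a :: complex_inner) (x - y) = cinner z x - cinner z y"
  using cinner_add_right[of z x "- y"] by (simp add: cinner_minus_right)

lemmas cinner_simps = cinner_add_left cinner_add_right cinner_scaleC_left cinner_scaleC_right
  cinner_minus_left cinner_minus_right cinner_diff_left cinner_diff_right

lemma cinner_self: "cinner x (x :: 'a :: complex_inner) = complex_of_real ((norm x)\<^sup>2)"
proof -
  have "Im (cinner x x) = 0"
    using cinner_commute[of x x] by (metis complex_cnj_cancel_iff Im_complex_of_real
        Reals_cnj_iff complex_is_Real_iff)
  moreover have "Re (cinner x x) = (norm x)\<^sup>2"
    by (simp add: inner_eq_Re_cinner[symmetric] power2_norm_eq_inner)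
  ultimately show ?thesis
    by (simp add: complex_eq_iff)
qed

lemma cinner_self_eq_0_iff [simp]: "cinner x (x :: 'a :: complex_inner) = 0 \<longleftrightarrow> x = 0"
  by (simp add: cinner_self)

lemma cinner_eq_0_commute: "cinner x (y :: 'a :: complex_inner) = 0 \<longleftrightarrow> cinner y x = 0"
  using cinner_commute[of x y] by simp

lemma cinner_right_unique:
  fixes u v :: "'a :: complex_inner"
  assumes "\<And>e. cinner e u = cinner e v"
  shows "u = v"
  using assms[of "u - v"] cinner_self_eq_0_iff[of "u - v"] by (simp add: cinner_diff_right)


section \<open>Orthogonal projections onto subspaces\<close>

text \<open>Double adjoints need only this consequence of closedness, and unlike closedness it passes to
  finite-dimensional extensions by a direct construction.\<close>

definition orthocomplemented :: "'a :: complex_inner set \<Rightarrow> bool" where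
  "orthocomplemented G \<longleftrightarrow> (\<forall>x. \<exists>g\<in>G. \<forall>y\<in>G. cinner (x - g) y = 0)"

lemma nearest_point_orthogonal:
  fixes v :: "'a :: complex_inner"
  assumes G: "cvs.subspace G" and min: "\<And>y. y \<in> G \<Longrightarrow> norm v \<le> norm (v - y)"
    and y: "y \<in> G"
  shows "cinner v y = 0"
proof -
  have real: "inner v w = 0" if w: "w \<in> G" for w
  proof (cases "w = 0")
    case False
    \<comment> \<open>This \<open>t\<close> minimises the quadratic polynomial \<open>t \<mapsto> \<parallel>v - t w\<parallel>\<^sup>2\<close>.\<close>
    define t where "t = inner v w / inner w w"
    have "t *\<^sub>R w \<in> G"
      using G w by (simp add: scaleR_scaleC cvs.subspace_scale)
    then have "(norm v)\<^sup>2 \<le> (norm (v - t *\<^sub>R w))\<^sup>2"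
      using min by (simp add: power_mono)
    also have "\<dots> = (norm v)\<^sup>2 - 2 * t * inner v w + t\<^sup>2 * inner w w"
      unfolding power2_norm_eq_inner
      by (simp add: inner_diff_left inner_diff_right inner_commute[of w v] power2_eq_square algebra_simps)
    also have "\<dots> = (norm v)\<^sup>2 - (inner v w)\<^sup>2 / inner w w"
      using False by (simp add: t_def field_simps power2_eq_square)
    finally have "(inner v w)\<^sup>2 / inner w w \<le> 0"
      by simp
    moreover have "0 < inner w w"
      using False by simp
    ultimately have "(inner v w)\<^sup>2 \<le> 0"
      by (meson divide_pos_pos not_le)
    then show ?thesis
      by simp
  qed simp
  \<comment> \<open>The real inner product with \<open>i y\<close> is the imaginary part of the complex one with \<open>y\<close>.\<close>
  have "\<i> *\<^sub>C y \<in> G"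
    using G y by (simp add: cvs.subspace_scale)
  from real[OF this] have "Im (cinner v y) = 0"
    by (simp add: inner_eq_Re_cinner cinner_scaleC_right)
  with real[OF y] show ?thesis
    by (simp add: complex_eq_iff inner_eq_Re_cinner)
qed

text \<open>The projection theorem. A sequence in the subspace whose distances to \<open>x\<close> approach the
  infimum is Cauchy by the parallelogram law, because the midpoint of two of its members again
  lies in the subspace.\<close>

lemma closed_subspace_orthocomplemented:
  fixes G :: "'a :: chilbert_space set"
  assumes G: "cvs.subspace G" and cl: "closed G"
  shows "orthocomplemented G"
  unfolding orthocomplemented_def
proof
  fix x
  have ne: "G \<noteq> {}"
    using cvs.subspace_0[OF G] by blast
  define \<delta> where "\<delta> = infdist x G"
  have \<delta>0: "0 \<le> \<delta>"
    by (simp add: \<delta>_def infdist_nonneg)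
  have \<delta>_le: "\<delta> \<le> norm (x - y)" if "y \<in> G" for y
    using infdist_le[OF that, of x] by (simp add: \<delta>_def dist_norm)
  have "\<exists>g. g \<in> G \<and> norm (x - g) < \<delta> + 1 / real (Suc n)" for n
  proof -
    have "\<not> \<delta> + 1 / real (Suc n) \<le> (INF y\<in>G. dist x y)"
      using ne by (simp add: \<delta>_def infdist_notempty)
    then have "\<exists>y\<in>G. \<not> \<delta> + 1 / real (Suc n) \<le> dist x y"
      using cINF_greatest[OF ne, of "\<delta> + 1 / real (Suc n)" "dist x"] by blast
    then show ?thesis
      by (auto simp: dist_norm not_le)
  qed
  then obtain g where gG: "\<And>n. g n \<in> G" and gd: "\<And>n. norm (x - g n) < \<delta> + 1 / real (Suc n)"
    by metis
  have par: "(norm (g m - g n))\<^sup>2 \<le> 2 * (norm (x - g m))\<^sup>2 + 2 * (norm (x - g n))\<^sup>2 - 4 * \<delta>\<^sup>2"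
    for m n
  proof -
    have "(1/2) *\<^sub>R (g m + g n) \<in> G"
      using G gG by (simp add: scaleR_scaleC cvs.subspace_scale cvs.subspace_add)
    then have "\<delta> \<le> norm (x - (1/2) *\<^sub>R (g m + g n))"
      by (rule \<delta>_le)
    also have "x - (1/2) *\<^sub>R (g m + g n) = (1/2) *\<^sub>R ((x - g m) + (x - g n))"
      by (simp add: scaleR_add_right scaleR_diff_right scaleR_add_left[symmetric] algebra_simps)
    finally have "2 * \<delta> \<le> norm ((x - g m) + (x - g n))"
      by simp
    then have "4 * \<delta>\<^sup>2 \<le> (norm ((x - g m) + (x - g n)))\<^sup>2"
      using \<delta>0 power_mono[of "2 * \<delta>" _ 2] by (simp add: power_mult_distrib)
    moreover have "(norm (b - a))\<^sup>2 + (norm (a + b))\<^sup>2 = 2 * (norm a)\<^sup>2 + 2 * (norm b)\<^sup>2"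
      for a b :: 'a
      unfolding power2_norm_eq_inner by (simp add: inner_simps)
    from this[of "x - g n" "x - g m"] have "(norm (g m - g n))\<^sup>2 +
        (norm ((x - g m) + (x - g n)))\<^sup>2 = 2 * (norm (x - g m))\<^sup>2 + 2 * (norm (x - g n))\<^sup>2"
      by (simp add: norm_minus_commute add.commute)
    ultimately show ?thesis
      by linarith
  qed
  have "(\<lambda>n. \<delta> + 1 / real (Suc n)) \<longlonglongrightarrow> \<delta> + 0"
    by (intro tendsto_add tendsto_const LIMSEQ_Suc[OF lim_1_over_n])
  then have lim: "(\<lambda>n. norm (x - g n)) \<longlonglongrightarrow> \<delta>"
    using tendsto_sandwich[of "\<lambda>_. \<delta>" "\<lambda>n. norm (x - g n)" sequentially
        "\<lambda>n. \<delta> + 1 / real (Suc n)" \<delta>] \<delta>_le[OF gG] less_imp_le[OF gd]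
    by (simp only: always_eventually tendsto_const add_0_right simp_thms)
  have "Cauchy g"
  proof (rule metric_CauchyI)
    fix e :: real
    assume e: "0 < e"
    have "(\<lambda>n. (norm (x - g n))\<^sup>2) \<longlonglongrightarrow> \<delta>\<^sup>2"
      using lim by (rule tendsto_power)
    moreover have "\<delta>\<^sup>2 < \<delta>\<^sup>2 + e\<^sup>2 / 4"
      using e by simp
    ultimately have "\<forall>\<^sub>F n in sequentially. (norm (x - g n))\<^sup>2 < \<delta>\<^sup>2 + e\<^sup>2 / 4"
      by (rule order_tendstoD(2))
    then obtain N where N: "\<And>n. n \<ge> N \<Longrightarrow> (norm (x - g n))\<^sup>2 < \<delta>\<^sup>2 + e\<^sup>2 / 4"
      by (auto simp: eventually_sequentially)
    have "dist (g m) (g n) < e" if "m \<ge> N" "n \<ge> N" for m n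
    proof -
      have "(norm (g m - g n))\<^sup>2 < e\<^sup>2"
        using par[of m n] N[OF that(1)] N[OF that(2)] by linarith
      then show ?thesis
        using e by (simp add: dist_norm power2_less_imp_less)
    qed
    then show "\<exists>N. \<forall>m\<ge>N. \<forall>n\<ge>N. dist (g m) (g n) < e"
      by blast
  qed
  then obtain p where p: "g \<longlonglongrightarrow> p"
    using Cauchy_convergent convergent_def by blast
  have pG: "p \<in> G"
    using cl gG p closed_sequentially by blast
  have "(\<lambda>n. norm (x - g n)) \<longlonglongrightarrow> norm (x - p)"
    by (intro tendsto_intros p)
  then have xp: "norm (x - p) = \<delta>"
    using lim LIMSEQ_unique by blast
  have "cinner (x - p) y = 0" if "y \<in> G" for y
  proof (rule nearest_point_orthogonal[OF G _ that])
    fix w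
    assume "w \<in> G"
    then have "p + w \<in> G"
      using G pG by (simp add: cvs.subspace_add)
    then show "norm (x - p) \<le> norm (x - p - w)"
      using \<delta>_le[of "p + w"] xp by (simp add: algebra_simps)
  qed
  then show "\<exists>g\<in>G. \<forall>y\<in>G. cinner (x - g) y = 0"
    using pG by blast
qed

text \<open>One step of the Gram-Schmidt process: \<open>b\<close> is replaced by its component \<open>w\<close> orthogonal to the
  span of \<open>B\<close>.\<close>

lemma orthocomplemented_span_insert:
  fixes B :: "'a :: complex_inner set"
  assumes "orthocomplemented (cvs.span B)"
  shows "orthocomplemented (cvs.span (insert b B))"
proof -
  obtain p where p: "p \<in> cvs.span B" "\<And>y. y \<in> cvs.span B \<Longrightarrow> cinner (b - p) y = 0"
    using assms unfolding orthocomplemented_def by metis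
  define w where "w = b - p"
  show ?thesis
    unfolding orthocomplemented_def
  proof
    fix x
    obtain g where g: "g \<in> cvs.span B" "\<And>y. y \<in> cvs.span B \<Longrightarrow> cinner (x - g) y = 0"
      using assms unfolding orthocomplemented_def by metis
    \<comment> \<open>If \<open>w = 0\<close> the quotient is \<open>0\<close> and the correction term vanishes.\<close>
    define c where "c = cinner (x - g) w / cinner w w"
    have wB: "cinner w y = 0" if "y \<in> cvs.span B" for y
      using p(2)[OF that] by (simp add: w_def)
    have sub: "cvs.span B \<subseteq> cvs.span (insert b B)"
      by (simp add: cvs.span_mono subset_insertI)
    have wI: "w \<in> cvs.span (insert b B)"
      unfolding w_def by (rule cvs.span_diff) (use p(1) sub in \<open>auto intro: cvs.span_base\<close>)
    have "g + c *\<^sub>C w \<in> cvs.span (insert b B)"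
      using g(1) sub wI by (auto intro!: cvs.span_add cvs.span_scale)
    moreover have "cinner (x - (g + c *\<^sub>C w)) y = 0" if yI: "y \<in> cvs.span (insert b B)" for y
    proof -
      obtain k where k: "y - k *\<^sub>C b \<in> cvs.span B"
        using yI by (auto simp: cvs.span_breakdown_eq)
      define y' where "y' = y - k *\<^sub>C b + k *\<^sub>C p"
      have y': "y' \<in> cvs.span B"
        unfolding y'_def using k p(1) by (auto intro!: cvs.span_add cvs.span_scale)
      have y: "y = y' + k *\<^sub>C w"
        by (simp add: y'_def w_def cvs.scale_right_diff_distrib)
      have "cinner (x - g - c *\<^sub>C w) w = 0"
        by (cases "w = 0") (simp_all add: cinner_simps c_def)
      moreover have "cinner (x - g - c *\<^sub>C w) y' = 0"
        using g(2)[OF y'] wB[OF y'] by (simp add: cinner_simps)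
      ultimately show ?thesis
        by (simp add: y cinner_add_right cinner_scaleC_right diff_diff_eq[symmetric])
    qed
    ultimately show "\<exists>g\<in>cvs.span (insert b B). \<forall>y\<in>cvs.span (insert b B). cinner (x - g) y = 0"
      by blast
  qed
qed

lemma finite_cdim_subset: "finite_cdim S \<Longrightarrow> R \<subseteq> S \<Longrightarrow> finite_cdim R"
  unfolding finite_cdim_def by (meson order_trans)

lemma finite_cdim_orthocomplemented:
  fixes G :: "'a :: complex_inner set"
  assumes G: "cvs.subspace G" and fin: "finite_cdim G"
  shows "orthocomplemented G"
proof -
  obtain C where C: "finite C" "G \<subseteq> cvs.span C"
    using fin by (auto simp: finite_cdim_def)
  obtain B where B: "B \<subseteq> G" "cvs.independent B" "G \<subseteq> cvs.span B"
    using cvs.maximal_independent_subset[of G] by blast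
  have "finite B"
    using cvs.independent_span_bound[OF C(1) B(2)] B(1) C(2) by blast
  then have "orthocomplemented (cvs.span B)"
  proof induction
    case empty
    then show ?case
      by (simp add: orthocomplemented_def)
  qed (rule orthocomplemented_span_insert)
  moreover have "cvs.span B = G"
    using B G by (metis cvs.span_minimal subset_antisym)
  ultimately show ?thesis
    by simp
qed

text \<open>Project onto \<open>A\<close>, and then project the remainder onto the
  finite-dimensional space of those vectors of \<open>B\<close> that are orthogonal to \<open>A\<close>.\<close>

lemma orthocomplemented_finite_extension:
  fixes A B :: "'a :: complex_inner set"
  assumes A: "cvs.subspace A" "orthocomplemented A" and B: "cvs.subspace B" "A \<subseteq> B"
    and fin: "finite_cdim {b \<in> B. \<forall>a\<in>A. cinner b a = 0}"
  shows "orthocomplemented B"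
proof -
  define G where "G = {b \<in> B. \<forall>a\<in>A. cinner b a = 0}"
  have "cvs.subspace G"
    using B(1) by (auto simp: G_def cvs.subspace_def cinner_simps)
  then have G: "orthocomplemented G"
    using fin finite_cdim_orthocomplemented by (simp add: G_def)
  show ?thesis
    unfolding orthocomplemented_def
  proof
    fix x
    obtain a where a: "a \<in> A" "\<And>y. y \<in> A \<Longrightarrow> cinner (x - a) y = 0"
      using A(2) unfolding orthocomplemented_def by metis
    obtain g where g: "g \<in> G" "\<And>y. y \<in> G \<Longrightarrow> cinner (x - a - g) y = 0"
      using G unfolding orthocomplemented_def by metis
    have "cinner (x - (a + g)) y = 0" if y: "y \<in> B" for y
    proof -
      obtain b where b: "b \<in> A" "\<And>w. w \<in> A \<Longrightarrow> cinner (y - b) w = 0"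
        using A(2) unfolding orthocomplemented_def by metis
      have "y - b \<in> G"
        using b B y by (auto simp: G_def intro: cvs.subspace_diff)
      then have "cinner (x - a - g) (y - b) = 0"
        by (rule g(2))
      moreover have "cinner (x - a - g) b = 0"
        using a(2)[OF b(1)] g(1) b(1) by (simp add: G_def cinner_diff_left)
      ultimately show ?thesis
        by (simp add: cinner_diff_right diff_diff_eq)
    qed
    moreover have "a + g \<in> B"
      using a(1) g(1) B by (auto simp: G_def intro: cvs.subspace_add)
    ultimately show "\<exists>g\<in>B. \<forall>y\<in>B. cinner (x - g) y = 0"
      by blast
  qed
qed

text \<open>Riesz representation in finite dimension: a vector orthogonal to the kernel, suitably
  scaled, represents the functional.\<close>

lemma finite_cdim_riesz:
  fixes \<phi> :: "'e :: complex_inner \<Rightarrow> complex"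
  assumes fin: "finite_cdim (UNIV :: 'e set)"
    and add: "\<And>x y. \<phi> (x + y) = \<phi> x + \<phi> y" and scale: "\<And>c x. \<phi> (c *\<^sub>C x) = c * \<phi> x"
  shows "\<exists>u. \<forall>e. \<phi> e = cinner e u"
proof (cases "\<forall>e. \<phi> e = 0")
  case True
  then show ?thesis
    by (intro exI[of _ 0]) simp
next
  case False
  then obtain x where x: "\<phi> x \<noteq> 0"
    by blast
  have diff: "\<phi> (a - b) = \<phi> a - \<phi> b" for a b
    using add[of "a - b" b] by simp
  define N where "N = {e. \<phi> e = 0}"
  have "\<phi> 0 = 0"
    using add[of 0 0] by simp
  then have "cvs.subspace N"
    by (auto simp: N_def cvs.subspace_def add scale)
  moreover have "finite_cdim N"
    using fin by (rule finite_cdim_subset) simp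
  ultimately have "orthocomplemented N"
    by (rule finite_cdim_orthocomplemented)
  then obtain g where g: "g \<in> N" "\<And>y. y \<in> N \<Longrightarrow> cinner (x - g) y = 0"
    unfolding orthocomplemented_def by metis
  define w where "w = x - g"
  have \<phi>w: "\<phi> w \<noteq> 0"
    using x g(1) by (simp add: w_def diff N_def)
  then have w: "w \<noteq> 0"
    using \<open>\<phi> 0 = 0\<close> by auto
  have "\<phi> e = cinner e (cnj (\<phi> w / cinner w w) *\<^sub>C w)" for e
  proof -
    have "e - (\<phi> e / \<phi> w) *\<^sub>C w \<in> N"
      using \<phi>w by (simp add: N_def diff scale)
    then have "cinner (e - (\<phi> e / \<phi> w) *\<^sub>C w) w = 0"
      using g(2) cinner_eq_0_commute w_def by blast
    then show ?thesis
      using \<phi>w w by (simp add: cinner_simps field_simps)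
  qed
  then show ?thesis
    by blast
qed

lemma pairing_adjoint_eqI:
  assumes "\<And>e. p (K e) x = cinner e u"
  shows "pairing_adjoint p K x = u"
  unfolding pairing_adjoint_def
proof (rule the_equality)
  fix v
  assume "\<forall>e. p (K e) x = cinner e v"
  with assms show "v = u"
    by (metis cinner_right_unique)
qed (use assms in blast)

text \<open>The adjoint is a definite description; finite dimension of its target space provides the
  vector that it describes.\<close>

lemma pairing_adjoint_finite_cdim:
  fixes K :: "'e :: complex_inner \<Rightarrow> 'y"
  assumes "finite_cdim (UNIV :: 'e set)"
    and "\<And>a b. p (K (a + b)) x = p (K a) x + p (K b) x"
    and "\<And>c a. p (K (c *\<^sub>C a)) x = c * p (K a) x"
  shows "p (K e) x = cinner e (pairing_adjoint p K x)"
proof -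
  obtain u where u: "\<And>e. p (K e) x = cinner e u"
    using finite_cdim_riesz[of "\<lambda>e. p (K e) x"] assms by blast
  then have "pairing_adjoint p K x = u"
    by (rule pairing_adjoint_eqI)
  with u show ?thesis
    by simp
qed


section \<open>Adjoints of linear relations\<close>

lemma adjoint_op_iff: "(g, k) \<in> adjoint_op A \<longleftrightarrow> (\<forall>f h. (f, h) \<in> A \<longrightarrow> cinner h g = cinner f k)"
  by (auto simp: adjoint_op_def)

lemma adjoint_op_antimono: "A \<subseteq> B \<Longrightarrow> adjoint_op B \<subseteq> adjoint_op A"
  by (auto simp: adjoint_op_def)

lemma subspace_adjoint_op: "cvs.subspace (adjoint_op A)"
  by (auto simp: cvs.subspace_def adjoint_op_iff scaleC_prod_def cinner_simps zero_prod_def)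

lemma subset_adjoint_adjoint: "A \<subseteq> adjoint_op (adjoint_op A)"
proof -
  have "cinner k f = cinner g h" if "cinner h g = cinner f k" for f g h k :: 'a
    using that cinner_commute[of k f] cinner_commute[of g h] cinner_commute[of f k]
      cinner_commute[of h g] by metis
  then show ?thesis
    unfolding adjoint_op_def by fast
qed

text \<open>Up to a rotation by a right angle in the product space, the adjoint is the orthogonal
  complement of the graph.\<close>

lemma orthogonal_imp_adjoint:
  assumes "\<And>a. a \<in> A \<Longrightarrow> cinner (v, w) a = 0"
  shows "(w, - v) \<in> adjoint_op A"
  unfolding adjoint_op_iff
proof (intro allI impI)
  fix f h
  assume "(f, h) \<in> A"
  from assms[OF this] have "cinner (f, h) (v, w) = 0"
    by (simp add: cinner_eq_0_commute)
  then show "cinner h w = cinner f (- v)"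
    by (simp add: cinner_prod_def cinner_minus_right add_eq_0_iff)
qed

text \<open>Split an element of the second adjoint as \<open>a + (v, w)\<close> with \<open>a \<in> A\<close> and \<open>(v, w)\<close> orthogonal to
  \<open>A\<close>. Then \<open>(v, w)\<close> lies in the second adjoint and \<open>(w, -v)\<close> in the adjoint, and pairing the
  two gives \<open>-\<parallel>v\<parallel>\<^sup>2 = \<parallel>w\<parallel>\<^sup>2\<close>.\<close>

lemma adjoint_adjoint_eq:
  assumes "orthocomplemented A"
  shows "adjoint_op (adjoint_op A) = A"
proof
  show "adjoint_op (adjoint_op A) \<subseteq> A"
  proof
    fix x
    assume x: "x \<in> adjoint_op (adjoint_op A)"
    obtain a where a: "a \<in> A" "\<And>y. y \<in> A \<Longrightarrow> cinner (x - a) y = 0"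
      using assms unfolding orthocomplemented_def by metis
    obtain v w where vw: "x - a = (v, w)"
      by fastforce
    have "(w, - v) \<in> adjoint_op A"
      using a(2) vw by (intro orthogonal_imp_adjoint) simp
    moreover have "(v, w) \<in> adjoint_op (adjoint_op A)"
      using x a(1) subset_adjoint_adjoint[of A] vw
      by (metis cvs.subspace_diff subspace_adjoint_op subsetD)
    ultimately have "cinner (- v) v = cinner w w"
      by (simp add: adjoint_op_iff)
    then have "complex_of_real ((norm v)\<^sup>2 + (norm w)\<^sup>2) = 0"
      by (simp only: cinner_minus_left cinner_self of_real_add) (metis neg_eq_iff_add_eq_0)
    then have "(norm v)\<^sup>2 + (norm w)\<^sup>2 = 0"
      using of_real_eq_0_iff by blast
    then have "v = 0 \<and> w = 0"
      by (simp add: add_nonneg_eq_0_iff)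
    then have "x = a"
      using vw by (simp add: zero_prod_def[symmetric])
    then show "x \<in> A"
      using a(1) by simp
  qed
qed (rule subset_adjoint_adjoint)

text \<open>Von Neumann's formula \<open>Dom A\<^sup>* = Dom A + N\<^sub>i + N\<^sub>-\<^sub>i\<close>, in the form that the graph complement of
  \<open>A\<close> in \<open>A\<^sup>*\<close> is spanned by deficiency vectors. If \<open>(g, k) \<in> A\<^sup>*\<close> is orthogonal to \<open>A\<close>, then
  \<open>A\<^sup>* g = k\<close> and \<open>A\<^sup>* k = -g\<close>, so \<open>g - i k\<close> and \<open>g + i k\<close> are eigenvectors for \<open>i\<close> and \<open>-i\<close>.\<close>

lemma finite_cdim_adjoint_complement:
  fixes A :: "('h :: complex_inner \<times> 'h) set"
  assumes "finite_cdim (deficiency_space A \<i>)" "finite_cdim (deficiency_space A (- \<i>))"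
  shows "finite_cdim {b \<in> adjoint_op A. \<forall>a\<in>A. cinner b a = 0}"
proof -
  obtain B1 where B1: "finite B1" "deficiency_space A \<i> \<subseteq> cvs.span B1"
    using assms(1) by (auto simp: finite_cdim_def)
  obtain B2 where B2: "finite B2" "deficiency_space A (- \<i>) \<subseteq> cvs.span B2"
    using assms(2) by (auto simp: finite_cdim_def)
  have graph_span: "(u, c *\<^sub>C u) \<in> cvs.span ((\<lambda>u. (u, c *\<^sub>C u)) ` B)"
    if "u \<in> cvs.span B" for c and u :: 'h and B
    using that
  proof (induction rule: cvs.span_induct_alt)
    case base
    then show ?case
      using cvs.span_zero[of "(\<lambda>u. (u, c *\<^sub>C u)) ` B"] by (simp add: zero_prod_def)
  next
    case (step d x y)
    have "(d *\<^sub>C x + y, c *\<^sub>C (d *\<^sub>C x + y)) = d *\<^sub>C (x, c *\<^sub>C x) + (y, c *\<^sub>C y)"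
      by (simp add: scaleC_prod_def scaleC_add_right scaleC_scaleC mult.commute)
    also have "\<dots> \<in> cvs.span ((\<lambda>u. (u, c *\<^sub>C u)) ` B)"
      using step by (intro cvs.span_add cvs.span_scale) (auto intro: cvs.span_base)
    finally show ?case .
  qed
  let ?C = "(\<lambda>u. (u, \<i> *\<^sub>C u)) ` B1 \<union> (\<lambda>u. (u, (- \<i>) *\<^sub>C u)) ` B2"
  have "b \<in> cvs.span ?C" if b: "b \<in> adjoint_op A" "\<forall>a\<in>A. cinner b a = 0" for b
  proof -
    obtain g k where gk: "b = (g, k)"
      by fastforce
    have 1: "(g, k) \<in> adjoint_op A" and 2: "(k, - g) \<in> adjoint_op A"
      using b gk by (auto intro: orthogonal_imp_adjoint)
    define u where "u = (1/2) *\<^sub>C (g - \<i> *\<^sub>C k)"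
    define v where "v = (1/2) *\<^sub>C (g + \<i> *\<^sub>C k)"
    have half: "(1/2) *\<^sub>C x + (1/2) *\<^sub>C x = x" for x :: 'h
      by (simp add: scaleC_add_left[symmetric] scaleC_one)
    have "(1/2) *\<^sub>C ((g, k) - \<i> *\<^sub>C (k, - g)) \<in> adjoint_op A"
      using 1 2 by (intro cvs.subspace_scale cvs.subspace_diff subspace_adjoint_op)
    moreover have "(1/2) *\<^sub>C ((g, k) - \<i> *\<^sub>C (k, - g)) = (u, \<i> *\<^sub>C u)"
      by (simp add: u_def scaleC_prod_def scaleC_scaleC cvs.scale_right_diff_distrib
          cvs.scale_minus_right scaleC_add_right algebra_simps)
    ultimately have u: "u \<in> cvs.span B1"
      using B1(2) by (auto simp: deficiency_space_def)
    have "(1/2) *\<^sub>C ((g, k) + \<i> *\<^sub>C (k, - g)) \<in> adjoint_op A"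
      using 1 2 by (intro cvs.subspace_scale cvs.subspace_add subspace_adjoint_op)
    moreover have "(1/2) *\<^sub>C ((g, k) + \<i> *\<^sub>C (k, - g)) = (v, (- \<i>) *\<^sub>C v)"
      by (simp add: v_def scaleC_prod_def scaleC_scaleC cvs.scale_right_diff_distrib
          cvs.scale_minus_right scaleC_add_right algebra_simps)
    ultimately have v: "v \<in> cvs.span B2"
      using B2(2) by (auto simp: deficiency_space_def)
    have "u + v = g"
      unfolding u_def v_def cvs.scale_right_diff_distrib scaleC_add_right using half[of g]
      by (simp add: algebra_simps)
    moreover have "\<i> *\<^sub>C u + (- \<i>) *\<^sub>C v = k"
      unfolding u_def v_def cvs.scale_right_diff_distrib scaleC_add_right scaleC_scaleC
      using half[of k] by (simp add: algebra_simps)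
    ultimately have "b = (u, \<i> *\<^sub>C u) + (v, (- \<i>) *\<^sub>C v)"
      by (simp add: gk)
    also have "\<dots> \<in> cvs.span ?C"
    proof (rule cvs.span_add)
      show "(u, \<i> *\<^sub>C u) \<in> cvs.span ?C"
        using graph_span[OF u, of \<i>] cvs.span_mono[of "(\<lambda>u. (u, \<i> *\<^sub>C u)) ` B1" ?C] by blast
      show "(v, (- \<i>) *\<^sub>C v) \<in> cvs.span ?C"
        using graph_span[OF v, of "- \<i>"] cvs.span_mono[of "(\<lambda>u. (u, (- \<i>) *\<^sub>C u)) ` B2" ?C]
        by blast
    qed
    finally show ?thesis .
  qed
  moreover have "finite ?C"
    using B1(1) B2(1) by simp
  ultimately show ?thesis
    unfolding finite_cdim_def by blast
qed

text \<open>Finite deficiency indices make every intermediate relation a finite-dimensional extension of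
  the closed relation \<open>A\<close>.\<close>

lemma adjoint_adjoint_intermediate:
  fixes A B :: "('h :: chilbert_space \<times> 'h) set"
  assumes A: "cvs.subspace A" "closed A"
    and fin: "finite_cdim (deficiency_space A \<i>)" "finite_cdim (deficiency_space A (- \<i>))"
    and B: "cvs.subspace B" "A \<subseteq> B" "B \<subseteq> adjoint_op A"
  shows "adjoint_op (adjoint_op B) = B"
proof (rule adjoint_adjoint_eq, rule orthocomplemented_finite_extension)
  show "orthocomplemented A"
    using A by (rule closed_subspace_orthocomplemented)
  show "finite_cdim {b \<in> B. \<forall>a\<in>A. cinner b a = 0}"
    by (rule finite_cdim_subset[OF finite_cdim_adjoint_complement[OF fin]]) (use B(3) in auto)
qed (use A B in auto)

text \<open>The sum of graphs as subspaces of the product space, not the graph of the operator sum; its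
  domain is the sum of the domains.\<close>

definition graph_sum :: "('h :: complex_vector \<times> 'h) set \<Rightarrow> ('h \<times> 'h) set \<Rightarrow> ('h \<times> 'h) set" where
  "graph_sum A B = {a + b | a b. a \<in> A \<and> b \<in> B}"

lemma subspace_graph_sum:
  "cvs.subspace A \<Longrightarrow> cvs.subspace B \<Longrightarrow> cvs.subspace (graph_sum A B)"
  unfolding graph_sum_def by (rule cvs.subspace_sums)

lemma graph_sum_upper1:
  assumes "cvs.subspace B"
  shows "A \<subseteq> graph_sum A B"
proof
  fix a
  assume "a \<in> A"
  then have "a + 0 \<in> graph_sum A B"
    using cvs.subspace_0[OF assms] unfolding graph_sum_def by blast
  then show "a \<in> graph_sum A B"
    by simp
qed

lemma graph_sum_upper2:
  assumes "cvs.subspace A"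
  shows "B \<subseteq> graph_sum A B"
proof
  fix a
  assume "a \<in> B"
  then have "0 + a \<in> graph_sum A B"
    using cvs.subspace_0[OF assms] unfolding graph_sum_def by blast
  then show "a \<in> graph_sum A B"
    by simp
qed

lemma adjoint_graph_sum:
  "cvs.subspace A \<Longrightarrow> cvs.subspace B \<Longrightarrow>
    adjoint_op (graph_sum A B) \<subseteq> adjoint_op A \<inter> adjoint_op B"
  by (simp add: adjoint_op_antimono graph_sum_upper1 graph_sum_upper2)

lemma graph_sum_least:
  "cvs.subspace C \<Longrightarrow> A \<subseteq> C \<Longrightarrow> B \<subseteq> C \<Longrightarrow> graph_sum A B \<subseteq> C"
  unfolding graph_sum_def by (blast intro: cvs.subspace_add)

lemma continuous_hilbert_ops:
  fixes R :: "'x :: complex_inner \<Rightarrow> 'y :: complex_inner"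
  assumes "R \<in> hilbert_ops"
  shows "continuous_on UNIV R"
proof -
  obtain C where "\<And>x. norm (R x) \<le> C * norm x"
    using assms by (auto simp: bounded_ops_def)
  moreover have "R (r *\<^sub>R x) = r *\<^sub>R R x" for r x
    using assms by (simp add: bounded_ops_def scaleR_scaleC)
  ultimately have "bounded_linear R"
    using assms by (intro bounded_linear_intro[where K = C])
      (auto simp: bounded_ops_def mult.commute)
  then show ?thesis
    by (simp add: linear_continuous_on)
qed

lemma norm_scaleC: "norm (c *\<^sub>C (x :: 'a :: complex_inner)) = cmod c * norm x"
proof -
  have "complex_of_real ((norm (c *\<^sub>C x))\<^sup>2) = complex_of_real ((cmod c * norm x)\<^sup>2)"
    unfolding cinner_self[symmetric] cinner_scaleC_left cinner_scaleC_right
    by (simp add: cinner_self power_mult_distrib complex_norm_square mult.assoc[symmetric]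
        del: of_real_power)
  then have "(norm (c *\<^sub>C x))\<^sup>2 = (cmod c * norm x)\<^sup>2"
    using of_real_eq_iff by blast
  then show ?thesis
    by (simp add: power2_eq_iff_nonneg)
qed

lemma resolvent_setD:
  fixes T :: "('h :: complex_inner \<times> 'h) set"
  assumes "z \<in> resolvent_set T"
  shows "\<exists>R\<in>hilbert_ops. \<forall>f k. (f, k) \<in> T \<longleftrightarrow> R (k - z *\<^sub>C f) = f"
proof -
  obtain R where R: "R \<in> hilbert_ops" "{(k - z *\<^sub>C f, f) | f k. (f, k) \<in> T} = graph_of R"
    using assms by (auto simp: resolvent_set_def F_resolvent_set_def)
  have "(f, k) \<in> T \<longleftrightarrow> (k - z *\<^sub>C f, f) \<in> {(k - z *\<^sub>C f, f) | f k. (f, k) \<in> T}" for f k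
    by auto
  then have "(f, k) \<in> T \<longleftrightarrow> R (k - z *\<^sub>C f) = f" for f k
    unfolding R(2) by (auto simp: graph_of_def)
  with R(1) show ?thesis
    by blast
qed

text \<open>Closedness of the main operator, which yields \<open>T\<^sup>*\<^sup>* = T\<close>, is a consequence of its having a
  continuous resolvent: \<open>T\<close> is the solution set of \<open>R (k - z f) = f\<close>.\<close>

lemma closed_if_resolvent:
  fixes T :: "('h :: complex_inner \<times> 'h) set"
  assumes "z \<in> resolvent_set T"
  shows "closed T"
proof -
  obtain R where R: "R \<in> hilbert_ops" "\<And>f k. (f, k) \<in> T \<longleftrightarrow> R (k - z *\<^sub>C f) = f"
    using resolvent_setD[OF assms] by blast
  have "(\<lambda>x. z *\<^sub>C x) \<in> (hilbert_ops :: ('h \<Rightarrow> 'h) set)"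
    by (auto simp: bounded_ops_def scaleC_add_right scaleC_scaleC mult.commute norm_scaleC
        intro!: exI[of _ "cmod z"])
  then have "continuous_on UNIV (\<lambda>x :: 'h. z *\<^sub>C x)"
    by (rule continuous_hilbert_ops)
  then have "continuous_on UNIV (\<lambda>p :: 'h \<times> 'h. z *\<^sub>C fst p)"
    by (rule continuous_on_compose2) (simp_all add: continuous_on_fst continuous_on_id)
  then have "continuous_on UNIV (\<lambda>p :: 'h \<times> 'h. snd p - z *\<^sub>C fst p)"
    by (intro continuous_on_diff continuous_on_snd continuous_on_id)
  then have "continuous_on UNIV (\<lambda>p. R (snd p - z *\<^sub>C fst p))"
    by (rule continuous_on_compose2[OF continuous_hilbert_ops[OF R(1)]]) simp
  then have "closed {p. R (snd p - z *\<^sub>C fst p) = fst p}"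
    by (intro closed_Collect_eq) (simp_all add: continuous_on_fst continuous_on_id)
  moreover have "{p. R (snd p - z *\<^sub>C fst p) = fst p} = T"
    by (auto simp: R(2))
  ultimately show ?thesis
    by simp
qed


section \<open>The resolvent equation in the rigged space\<close>

lemma subspace_plus_space: "cvs.subspace (plus_space A)"
proof -
  have "fst ` adjoint_op A = plus_space A"
    by (auto simp: plus_space_def Domain_fst)
  moreover have "cvs.subspace (fst ` adjoint_op A)"
    using subspace_adjoint_op[of A] unfolding cvs.subspace_def
    by (auto simp: scaleC_prod_def image_iff) (metis fst_conv fst_zero fst_add)+
  ultimately show ?thesis
    by simp
qed

lemma rig_embed_add: "rig_embed A (x + y) = rig_embed A x + rig_embed A y"
  by (auto simp: rig_embed_def fun_eq_iff cinner_add_left)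

lemma rig_embed_scaleC: "rig_embed A (c *\<^sub>C x) = c *\<^sub>C rig_embed A x"
  by (auto simp: rig_embed_def fun_eq_iff cinner_scaleC_left scaleC_fun_def scaleC_complex_def)

lemma rig_embed_diff: "rig_embed A (x - y) = rig_embed A x - rig_embed A y"
  by (auto simp: rig_embed_def fun_eq_iff cinner_diff_left)

text \<open>Testing \<open>S x\<close> against \<open>Dom T\<^sup>*\<close>, where the adjoint of \<open>S\<close> acts as \<open>T\<^sup>*\<close>, places \<open>(x, h)\<close> in
  \<open>T\<^sup>*\<^sup>*\<close>.\<close>

lemma star_extension_regular_imp_main:
  assumes ext: "rig_extends A (rig_adjoint A S) (adjoint_op T)"
    and T: "adjoint_op (adjoint_op T) = T"
    and x: "x \<in> plus_space A" and Sx: "S x = rig_embed A h"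
  shows "(x, h) \<in> T"
proof -
  have "(x, h) \<in> adjoint_op (adjoint_op T)"
    unfolding adjoint_op_iff[of x]
  proof (intro allI impI)
    fix g k
    assume "(g, k) \<in> adjoint_op T"
    with ext have g: "g \<in> plus_space A" and k: "rig_adjoint A S g = rig_embed A k"
      by (auto simp: rig_extends_def)
    have "cnj (cinner h g) = cinner k x"
      using fun_cong[OF k, of x] x g by (simp add: rig_adjoint_def rig_pairing_def rig_embed_def Sx)
    then show "cinner k x = cinner g h"
      by (simp add: cinner_commute[symmetric])
  qed
  then show ?thesis
    by (simp add: T)
qed

lemma rig_adjoint_regular_imp_adjoint:
  assumes ext: "rig_extends A S T"
    and x: "x \<in> plus_space A" and Sx: "rig_adjoint A S x = rig_embed A h"
  shows "(x, h) \<in> adjoint_op T"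
  unfolding adjoint_op_iff
proof (intro allI impI)
  fix g k
  assume "(g, k) \<in> T"
  with ext have g: "g \<in> plus_space A" and k: "S g = rig_embed A k"
    by (auto simp: rig_extends_def)
  have "cnj (cinner k x) = cinner h g"
    using fun_cong[OF Sx, of g] x g by (simp add: rig_adjoint_def rig_pairing_def rig_embed_def k)
  then show "cinner k x = cinner g h"
    by (metis cinner_commute)
qed

text \<open>Let \<open>C\<close> be the quasi-kernel, which is self-adjoint. On \<open>Dom C \<inter> Dom T\<close> both the real part and \<open>S\<close> have values in \<open>H\<^sub>1\<close>, hence so does the adjoint
  of \<open>S\<close>; such vectors lie in \<open>Dom T \<inter> Dom T\<^sup>* = Dom A\<close>. So the adjoint of the graph sum of \<open>C\<close> and
  \<open>T\<^sup>*\<close>, which lies in \<open>C\<^sup>* \<inter> T\<^sup>*\<^sup>* = C \<inter> T\<close>, is contained in \<open>A\<close>, and passing to adjoints once more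
  shows that the sum exhausts \<open>A\<^sup>*\<close>.\<close>

lemma plus_space_decomposition:
  fixes A :: "('h :: chilbert_space \<times> 'h) set"
  assumes A: "linear_operator A" "closed A" "finite_equal_deficiency_indices A"
    and T: "T \<in> class_Lambda A" "adjoint_op (adjoint_op T) = T"
    and S: "star_extension A T S"
  shows "adjoint_op A \<subseteq> graph_sum (quasi_kernel A S) (adjoint_op T)"
proof -
  define C where "C = quasi_kernel A S"
  have extT: "rig_extends A S T" and extT': "rig_extends A (rig_adjoint A S) (adjoint_op T)"
    and AT: "A \<subseteq> T" and AT': "A \<subseteq> adjoint_op T"
    and C: "cvs.subspace C" "adjoint_op C = C"
    using S by (auto simp: star_extension_def selfadjoint_operator_def linear_operator_def C_def)
  have svT: "single_valued T" and domA: "Domain A = Domain T \<inter> Domain (adjoint_op T)"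
    using T(1) by (auto simp: class_Lambda_def quasi_selfadjoint_extension_def linear_operator_def)
  have AC: "A \<subseteq> C"
  proof
    fix p
    assume p: "p \<in> A"
    obtain f h where fh: "p = (f, h)"
      by fastforce
    have "f \<in> plus_space A" "S f = rig_embed A h"
      using extT AT p by (auto simp: rig_extends_def fh)
    moreover have "rig_adjoint A S f = rig_embed A h"
      using extT' AT' p by (auto simp: rig_extends_def fh)
    ultimately show "p \<in> C"
      by (simp add: C_def quasi_kernel_def rig_Re_def fh scaleC_add_right
          scaleC_add_left[symmetric] scaleC_one)
  qed
  have CT: "C \<inter> T \<subseteq> A"
  proof
    fix p
    assume "p \<in> C \<inter> T"
    moreover obtain f h where fh: "p = (f, h)"
      by fastforce
    ultimately have f: "f \<in> plus_space A" and re: "rig_Re A S f = rig_embed A h"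
      and fT: "(f, h) \<in> T" and Sf: "S f = rig_embed A h"
      using extT by (auto simp: C_def quasi_kernel_def rig_extends_def)
    have "rig_adjoint A S f = 2 *\<^sub>C rig_Re A S f - S f"
      by (simp add: rig_Re_def scaleC_scaleC scaleC_one)
    also have "\<dots> = rig_embed A (2 *\<^sub>C h - h)"
      by (simp add: re Sf rig_embed_diff rig_embed_scaleC)
    finally have "(f, 2 *\<^sub>C h - h) \<in> adjoint_op T"
      by (rule rig_adjoint_regular_imp_adjoint[OF extT f])
    with fT domA obtain h' where "(f, h') \<in> A"
      by (metis DomainE DomainI IntI)
    with AT fT svT show "p \<in> A"
      unfolding fh by (metis single_valuedD subsetD)
  qed
  let ?B = "graph_sum C (adjoint_op T)"
  have "adjoint_op ?B \<subseteq> adjoint_op C \<inter> adjoint_op (adjoint_op T)"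
    by (intro adjoint_graph_sum C(1) subspace_adjoint_op)
  also have "\<dots> \<subseteq> A"
    using CT C(2) T(2) by simp
  finally have "adjoint_op A \<subseteq> adjoint_op (adjoint_op ?B)"
    by (rule adjoint_op_antimono)
  also have "\<dots> = ?B"
  proof (rule adjoint_adjoint_intermediate)
    show "cvs.subspace A" "closed A"
      using A by (auto simp: linear_operator_def)
    show "finite_cdim (deficiency_space A \<i>)" "finite_cdim (deficiency_space A (- \<i>))"
      using A(3) by (auto simp: finite_equal_deficiency_indices_def)
    show "cvs.subspace ?B"
      by (intro subspace_graph_sum C(1) subspace_adjoint_op)
    show "A \<subseteq> ?B"
      using AC graph_sum_upper1[OF subspace_adjoint_op] by blast
    show "?B \<subseteq> adjoint_op A"
      using adjoint_op_antimono[OF AC] adjoint_op_antimono[OF AT] C(2)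
      by (intro graph_sum_least subspace_adjoint_op) auto
  qed
  finally show ?thesis
    by (simp add: C_def)
qed

text \<open>Write \<open>f = d + t\<close> with \<open>d\<close> in the quasi-kernel and \<open>t\<close>
  in \<open>Dom T\<^sup>*\<close>. Modulo \<open>H\<^sub>1\<close> the adjoint of \<open>S\<close> kills \<open>t\<close> and agrees with \<open>-S\<close> at \<open>d\<close>, so
  \<open>Im S f\<close> equals \<open>S ((f + d) / 2i)\<close> modulo \<open>H\<^sub>1\<close>, and the resolvent of \<open>T\<close> removes the
  remainder in \<open>H\<^sub>1\<close>.\<close>

lemma resolvent_equation_solvable:
  fixes A :: "('h :: chilbert_space \<times> 'h) set"
  assumes S: "star_extension A T S" and z: "z \<in> resolvent_set T"
    and dec: "adjoint_op A \<subseteq> graph_sum (quasi_kernel A S) (adjoint_op T)"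
    and f: "f \<in> plus_space A"
  shows "\<exists>x \<in> plus_space A. S x - z *\<^sub>C rig_embed A x = rig_Im A S f"
proof -
  note sub = subspace_plus_space[of A]
  have extT: "rig_extends A S T" and extT': "rig_extends A (rig_adjoint A S) (adjoint_op T)"
    and rig: "S \<in> rig_ops A"
    using S by (auto simp: star_extension_def)
  have Sadd: "S (x + y) = S x + S y" if "x \<in> plus_space A" "y \<in> plus_space A" for x y
    using rig that by (auto simp: bounded_ops_def)
  have Sscale: "S (c *\<^sub>C x) = c *\<^sub>C S x" if "x \<in> plus_space A" for c x
    using rig that by (auto simp: bounded_ops_def)
  have Sminus: "S x \<in> minus_space A" if "x \<in> plus_space A" for x
    using rig that by (auto simp: bounded_ops_def)
  obtain f' where "(f, f') \<in> adjoint_op A"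
    using f by (auto simp: plus_space_def)
  with dec obtain d d' t t' where fdt: "f = d + t"
    and dd': "(d, d') \<in> quasi_kernel A S" and tt': "(t, t') \<in> adjoint_op T"
    by (fastforce simp: graph_sum_def)
  have d: "d \<in> plus_space A" and re: "rig_Re A S d = rig_embed A d'"
    using dd' by (auto simp: quasi_kernel_def)
  have t: "t \<in> plus_space A" and S't: "rig_adjoint A S t = rig_embed A t'"
    using tt' extT' by (auto simp: rig_extends_def)
  have "rig_adjoint A S d = 2 *\<^sub>C rig_Re A S d - S d"
    by (simp add: rig_Re_def scaleC_scaleC scaleC_one)
  then have S'd: "rig_adjoint A S d = rig_embed A (2 *\<^sub>C d') - S d"
    by (simp add: re rig_embed_scaleC)
  have S'f: "rig_adjoint A S f = rig_adjoint A S d + rig_adjoint A S t"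
    using Sminus d t by (auto simp: fdt rig_adjoint_def rig_pairing_def minus_space_def fun_eq_iff)
  define c where "c = 1 / (2 * \<i>)"
  define y where "y = c *\<^sub>C (f + d)"
  define h where "h = c *\<^sub>C (2 *\<^sub>C d' + t')"
  have y: "y \<in> plus_space A"
    unfolding y_def by (intro cvs.subspace_scale[OF sub] cvs.subspace_add[OF sub] f d)
  have fd: "f + d \<in> plus_space A"
    by (intro cvs.subspace_add[OF sub] f d)
  have "rig_Im A S f = c *\<^sub>C (S f - (rig_embed A (2 *\<^sub>C d') - S d + rig_embed A t'))"
    by (simp add: rig_Im_def c_def S'f S'd S't)
  also have "\<dots> = c *\<^sub>C (S (f + d) - rig_embed A (2 *\<^sub>C d' + t'))"
    by (simp add: Sadd f d rig_embed_add algebra_simps)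
  also have "\<dots> = S y - rig_embed A h"
    by (simp add: y_def h_def Sscale fd rig_embed_scaleC cvs.scale_right_diff_distrib)
  finally have im: "rig_Im A S f = S y - rig_embed A h" .
  obtain R where R: "\<And>f k. (f, k) \<in> T \<longleftrightarrow> R (k - z *\<^sub>C f) = f"
    using resolvent_setD[OF z] by blast
  \<comment> \<open>\<open>w\<close> solves \<open>(T - z) w = z y - h\<close>, so \<open>y + w\<close> is the solution sought.\<close>
  define w where "w = R (z *\<^sub>C y - h)"
  have "(w, z *\<^sub>C y - h + z *\<^sub>C w) \<in> T"
    by (simp add: R w_def)
  then have w: "w \<in> plus_space A" and Sw: "S w = rig_embed A (z *\<^sub>C y - h + z *\<^sub>C w)"
    using extT by (auto simp: rig_extends_def)
  have "S (y + w) - z *\<^sub>C rig_embed A (y + w) = rig_Im A S f"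
    by (simp add: Sadd y w Sw im rig_embed_add rig_embed_diff rig_embed_scaleC scaleC_add_right)
  moreover have "y + w \<in> plus_space A"
    by (intro cvs.subspace_add[OF sub] y w)
  ultimately show ?thesis
    by blast
qed

text \<open>The difference \<open>v\<close> of two solutions satisfies \<open>S v = z v\<close>, hence \<open>T v = z v\<close>, and \<open>T - z\<close> is
  injective.\<close>

lemma resolvent_equation_unique:
  fixes A :: "('h :: chilbert_space \<times> 'h) set"
  assumes S: "star_extension A T S" and z: "z \<in> resolvent_set T"
    and T: "adjoint_op (adjoint_op T) = T"
    and x: "x \<in> plus_space A" and y: "y \<in> plus_space A"
    and eq: "S x - z *\<^sub>C rig_embed A x = S y - z *\<^sub>C rig_embed A y"
  shows "x = y"
proof -
  have ext: "rig_extends A (rig_adjoint A S) (adjoint_op T)" and rig: "S \<in> rig_ops A"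
    using S by (auto simp: star_extension_def)
  have xy: "x - y \<in> plus_space A"
    using x y by (intro cvs.subspace_diff subspace_plus_space)
  have "S ((x - y) + y) = S (x - y) + S y"
    using rig xy y unfolding bounded_ops_def by blast
  then have "S (x - y) = S x - S y"
    by simp
  also have "\<dots> = rig_embed A (z *\<^sub>C (x - y))"
    using eq by (simp add: rig_embed_scaleC rig_embed_diff cvs.scale_right_diff_distrib
        algebra_simps)
  finally have xyT: "(x - y, z *\<^sub>C (x - y)) \<in> T"
    by (rule star_extension_regular_imp_main[OF ext T xy])
  obtain R where R: "R \<in> hilbert_ops" "\<And>f k. (f, k) \<in> T \<longleftrightarrow> R (k - z *\<^sub>C f) = f"
    using resolvent_setD[OF z] by blast
  have "R (0 + 0) = R 0 + R 0"
    using R(1) unfolding bounded_ops_def by blast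
  then have "R 0 = 0"
    by simp
  with xyT show ?thesis
    by (simp add: R(2))
qed

text \<open>The channel operator has the same range as the imaginary part of the state-space operator,
  so the right-hand sides treated above are the ones that occur.\<close>

lemma L_system_resolvent:
  fixes \<Theta> :: "('h :: chilbert_space, 'e :: chilbert_space) L_data"
  assumes L: "L_system \<Theta>" and z: "z \<in> resolvent_set (L_main \<Theta>)"
  shows "\<exists>!x. x \<in> plus_space (L_symm \<Theta>) \<and>
    L_state \<Theta> x - z *\<^sub>C rig_embed (L_symm \<Theta>) x = L_channel \<Theta> e"
proof -
  let ?A = "L_symm \<Theta>" and ?T = "L_main \<Theta>" and ?S = "L_state \<Theta>"
  have A: "linear_operator ?A" "closed ?A" "finite_equal_deficiency_indices ?A"
    and \<Lambda>: "?T \<in> class_Lambda ?A" and S: "star_extension ?A ?T ?S"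
    and ran: "range (L_channel \<Theta>) = rig_Im ?A ?S ` plus_space ?A"
    using L by (simp_all add: L_system_def Let_def)
  have "cvs.subspace ?T"
    using \<Lambda> by (auto simp: class_Lambda_def quasi_selfadjoint_extension_def linear_operator_def)
  then have T: "adjoint_op (adjoint_op ?T) = ?T"
    using closed_if_resolvent[OF z] adjoint_adjoint_eq closed_subspace_orthocomplemented by blast
  obtain f where f: "f \<in> plus_space ?A" "L_channel \<Theta> e = rig_Im ?A ?S f"
    using ran by blast
  obtain x where "x \<in> plus_space ?A" "?S x - z *\<^sub>C rig_embed ?A x = L_channel \<Theta> e"
    using resolvent_equation_solvable[OF S z plus_space_decomposition[OF A \<Lambda> T S] f(1)] f(2)
    by auto
  then show ?thesis
    using resolvent_equation_unique[OF S z T] by (intro ex1I[of _ x]) auto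
qed


section \<open>Transfer functions\<close>

lemma L_channel_linear:
  assumes "L_system \<Theta>"
  shows "L_channel \<Theta> (a + b) = L_channel \<Theta> a + L_channel \<Theta> b"
    and "L_channel \<Theta> (c *\<^sub>C a) = c *\<^sub>C L_channel \<Theta> a"
  using assms by (simp_all add: L_system_def Let_def bounded_ops_def)

lemma F_channel_linear:
  assumes "F_system \<Theta>"
  shows "F_channel \<Theta> (a + b) = F_channel \<Theta> a + F_channel \<Theta> b"
    and "F_channel \<Theta> (c *\<^sub>C a) = c *\<^sub>C F_channel \<Theta> a"
  using assms by (simp_all add: F_system_def Let_def bounded_ops_def)

lemma LF_channel_adjoint:
  fixes \<Theta>L :: "('h1 :: chilbert_space, 'e :: chilbert_space) L_data"
    and \<Theta>F :: "('h2 :: chilbert_space, 'e) F_data"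
  assumes fin: "finite_cdim (UNIV :: 'e set)" and L: "L_system \<Theta>L" and F: "F_system \<Theta>F"
  shows "pairing_adjoint LF_pairing (LF_channel (LF_coupling \<Theta>L \<Theta>F)) (x, h) =
    L_channel_adjoint \<Theta>L x + hilbert_adjoint (F_channel \<Theta>F) h"
proof (rule pairing_adjoint_eqI)
  fix e
  have "rig_pairing (L_channel \<Theta>L e) x = cinner e (L_channel_adjoint \<Theta>L x)"
    unfolding L_channel_adjoint_def
    by (rule pairing_adjoint_finite_cdim[OF fin])
       (simp_all add: rig_pairing_def L_channel_linear[OF L] scaleC_fun_def scaleC_complex_def)
  moreover have "cinner (F_channel \<Theta>F e) h = cinner e (hilbert_adjoint (F_channel \<Theta>F) h)"
    by (rule pairing_adjoint_finite_cdim[OF fin])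
       (simp_all add: F_channel_linear[OF F] cinner_simps)
  ultimately show "LF_pairing (LF_channel (LF_coupling \<Theta>L \<Theta>F) e) (x, h) =
      cinner e (L_channel_adjoint \<Theta>L x + hilbert_adjoint (F_channel \<Theta>F) h)"
    by (simp add: LF_pairing_def LF_coupling_def cinner_add_right)
qed

lemma F_resolvent_bij:
  assumes "z \<in> F_resolvent_set (graph_of M) F"
  shows "bij (\<lambda>h. M h - z *\<^sub>C F h)"
proof -
  obtain R where R: "{(k - z *\<^sub>C F f, f) | f k. (f, k) \<in> graph_of M} = graph_of R"
    using assms by (auto simp: F_resolvent_set_def)
  have "(M f - z *\<^sub>C F f, f) \<in> graph_of R" for f
    unfolding R[symmetric] by (auto simp: graph_of_def)
  then have 1: "R (M f - z *\<^sub>C F f) = f" for f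
    by (auto simp: graph_of_def)
  have "(k, R k) \<in> {(k - z *\<^sub>C F f, f) | f k. (f, k) \<in> graph_of M}" for k
    unfolding R by (auto simp: graph_of_def)
  then have 2: "M (R k) - z *\<^sub>C F (R k) = k" for k
    by (auto simp: graph_of_def)
  show ?thesis
    using 1 2 by (intro o_bij[of R]) (auto simp: fun_eq_iff)
qed

theorem theorem5:
  fixes J :: "'e :: chilbert_space \<Rightarrow> 'e"
    and \<Theta>L :: "('h1 :: chilbert_space, 'e) L_data"
    and \<Theta>F :: "('h2 :: chilbert_space, 'e) F_data"
    and \<Theta>LF :: "('h1, 'h2, 'e) LF_data"
    and z :: complex
  assumes "finite_cdim (UNIV :: 'e set)"
    and "signature_op J"
    and "L_system \<Theta>L" and "L_direction \<Theta>L = J"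
    and "F_system \<Theta>F" and "F_direction \<Theta>F = J"
    and "\<Theta>LF = LF_coupling \<Theta>L \<Theta>F"
    and "z \<in> resolvent_set (L_main \<Theta>L) \<inter> F_resolvent_set (graph_of (F_state \<Theta>F)) (F_proj \<Theta>F)"
  shows "LF_transfer \<Theta>LF z = L_transfer \<Theta>L z \<circ> F_transfer \<Theta>F z"
proof
  fix e
  note L = \<open>L_system \<Theta>L\<close> and F = \<open>F_system \<Theta>F\<close>
  have z1: "z \<in> resolvent_set (L_main \<Theta>L)"
    and z2: "z \<in> F_resolvent_set (graph_of (F_state \<Theta>F)) (F_proj \<Theta>F)"
    using assms(8) by auto
  let ?A = "L_symm \<Theta>L" and ?K1 = "L_channel \<Theta>L" and ?K2' = "hilbert_adjoint (F_channel \<Theta>F)"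
  have J: "J (a + b) = J a + J b" "J (c *\<^sub>C a) = c *\<^sub>C J a" for a b c
    using \<open>signature_op J\<close> by (auto simp: signature_op_def bounded_ops_def)
  define N where "N = (\<lambda>h. F_state \<Theta>F h - z *\<^sub>C F_proj \<Theta>F h)"
  have N: "bij N"
    unfolding N_def by (rule F_resolvent_bij[OF z2])
  define h where "h = inv N (F_channel \<Theta>F (J e))"
  have h: "N k = F_channel \<Theta>F (J e) \<longleftrightarrow> k = h" for k
    using N by (metis bij_inv_eq_iff h_def)
  define u where "u = e - (2 * \<i>) *\<^sub>C ?K2' h"
  have WF: "F_transfer \<Theta>F z e = u"
    by (simp add: F_transfer_def u_def h_def N_def assms(6))
  define P where "P = (\<lambda>x. x \<in> plus_space ?A \<and>
    L_state \<Theta>L x - z *\<^sub>C rig_embed ?A x = ?K1 (J u))"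
  define x where "x = (THE x. P x)"
  have ex1: "\<exists>!x. P x"
    unfolding P_def by (rule L_system_resolvent[OF L z1])
  then have x: "P k \<longleftrightarrow> k = x" for k
    unfolding x_def by (metis theI')
  \<comment> \<open>The off-diagonal entry of the coupling turns the input \<open>e\<close> of the \<open>L\<close>-system into \<open>u\<close>.\<close>
  have "e = u + (2 * \<i>) *\<^sub>C ?K2' h"
    by (simp add: u_def)
  then have K1: "?K1 (J e) = ?K1 (J u) + (2 * \<i>) *\<^sub>C ?K1 (J (?K2' h))"
    by (metis J L_channel_linear[OF L])
  have "(THE p. p \<in> LF_plus_space (LF_symm \<Theta>LF) \<and>
      LF_state \<Theta>LF p - z *\<^sub>C LF_embed (LF_symm \<Theta>LF) (LF_proj \<Theta>LF p) =
        LF_channel \<Theta>LF (LF_direction \<Theta>LF e)) = (x, h)"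
  proof (rule the_equality)
    have rows: "(k, m) \<in> LF_plus_space (LF_symm \<Theta>LF) \<and>
        LF_state \<Theta>LF (k, m) - z *\<^sub>C LF_embed (LF_symm \<Theta>LF) (LF_proj \<Theta>LF (k, m)) =
          LF_channel \<Theta>LF (LF_direction \<Theta>LF e) \<longleftrightarrow>
        k \<in> plus_space ?A \<and>
        L_state \<Theta>L k + (2 * \<i>) *\<^sub>C ?K1 (J (?K2' m)) - z *\<^sub>C rig_embed ?A k = ?K1 (J e) \<and>
        N m = F_channel \<Theta>F (J e)" for k m
      by (simp add: assms(7) LF_coupling_def LF_plus_space_def LF_embed_def N_def assms(4)
          scaleC_prod_def)
    also have "\<dots> k m \<longleftrightarrow> P k \<and> m = h" for k m
      unfolding h K1 P_def by (auto simp: algebra_simps)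
    finally have sol: "(k, m) \<in> LF_plus_space (LF_symm \<Theta>LF) \<and>
        LF_state \<Theta>LF (k, m) - z *\<^sub>C LF_embed (LF_symm \<Theta>LF) (LF_proj \<Theta>LF (k, m)) =
          LF_channel \<Theta>LF (LF_direction \<Theta>LF e) \<longleftrightarrow> (k, m) = (x, h)" for k m
      by (simp add: x)
    show "(x, h) \<in> LF_plus_space (LF_symm \<Theta>LF) \<and>
        LF_state \<Theta>LF (x, h) - z *\<^sub>C LF_embed (LF_symm \<Theta>LF) (LF_proj \<Theta>LF (x, h)) =
          LF_channel \<Theta>LF (LF_direction \<Theta>LF e)"
      by (simp only: sol)
    show "p = (x, h)" if "p \<in> LF_plus_space (LF_symm \<Theta>LF) \<and>
        LF_state \<Theta>LF p - z *\<^sub>C LF_embed (LF_symm \<Theta>LF) (LF_proj \<Theta>LF p) =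
          LF_channel \<Theta>LF (LF_direction \<Theta>LF e)" for p
      using that sol by (cases p) blast
  qed
  then have "LF_transfer \<Theta>LF z e =
      e - (2 * \<i>) *\<^sub>C (L_channel_adjoint \<Theta>L x + ?K2' h)"
    using LF_channel_adjoint[OF assms(1) L F] by (simp add: LF_transfer_def assms(7))
  also have "\<dots> = u - (2 * \<i>) *\<^sub>C L_channel_adjoint \<Theta>L x"
    by (simp add: u_def scaleC_add_right algebra_simps)
  also have "\<dots> = L_transfer \<Theta>L z u"
    by (simp add: L_transfer_def x_def P_def assms(4))
  finally show "LF_transfer \<Theta>LF z e = (L_transfer \<Theta>L z \<circ> F_transfer \<Theta>F z) e"
    by (simp add: WF)
qed

end
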